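(* Let $Q=(q_{ij})$ be a real symmetric $n\times n$ matrix with zero diagonal, $c\in\mathbb{R}^n$, $R_i=\{j:q_{ij}\neq0\}$, and let $\alpha_{ij}>0$, $\gamma_{ij}>0$, $\delta_{ij}>0$ for $j\in R_i$, $i=1,\dots,n$. Consider the MILP GW($\alpha,\gamma+\delta$) in variables $x_i$ and $y_{ij}$ ($j\in R_i$): maximize $\sum_{i=1}^n\sum_{j\in R_i}q_{ij}y_{ij}+\sum_{i=1}^n c_ix_i$ subject to $\sum_{j\in R_i}\alpha_{ij}(x_j-y_{ij})\le\left(\sum_{j\in R_i}\alpha_{ij}\right)(1-x_i)$ for $i=1,\dots,n$; $\sum_{j\in R_i}\gamma_{ij}y_{ij}+\sum_{j\in R_i}\delta_{ij}y_{ji}\le\left(\sum_{j\in R_i}\gamma_{ij}+\sum_{j\in R_i}\delta_{ij}\right)x_i$ for $i=1,\dots,n$; $x_i\in\{0,1\}$ for all $i$; $0\le y_{ij}\le 1$ for all $j\in R_i$, $i=1,\dots,n$. Then GW($\alpha,\gamma+\delta$) is a valid formulation of QUBO.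
   Context: QUBO is the problem: maximize $\sum_{i=1}^n\sum_{j\in R_i}q_{ij}x_ix_j+\sum_{i=1}^n c_ix_i$ over $x\in\{0,1\}^n$. An MILP in variables $(x,y)$ with objective $\sum_i\sum_{j\in R_i}q_{ij}y_{ij}+\sum_i c_ix_i$ is a valid formulation of QUBO if its optimal objective value equals the optimal value of QUBO and the $x$-part of every optimal solution of the MILP is an optimal solution of QUBO. *)

theory Defs
  imports "HOL-Analysis.Analysis"
begin

text \<open>A maximization problem is given by an objective function and a feasible set. Its optimal value
  is a maximum, i.e. it has to be attained.\<close>

definition optimal_solution :: "('a \<Rightarrow> real) \<Rightarrow> 'a set \<Rightarrow> 'a \<Rightarrow> bool" where
  "optimal_solution f S s \<longleftrightarrow> is_arg_max f (\<lambda>x. x \<in> S) s"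

definition is_optimal_value :: "('a \<Rightarrow> real) \<Rightarrow> 'a set \<Rightarrow> real \<Rightarrow> bool" where
  "is_optimal_value f S v \<longleftrightarrow> (\<exists>s. optimal_solution f S s \<and> f s = v)"

definition R :: "real^'n^'n \<Rightarrow> 'n \<Rightarrow> 'n set" where
  "R Q i = {j. Q $ i $ j \<noteq> 0}"

definition binary_vectors :: "(real^'n) set" where
  "binary_vectors = {x. \<forall>i. x $ i \<in> {0, 1}}"

definition qubo_objective :: "real^'n^'n \<Rightarrow> real^'n \<Rightarrow> real^'n \<Rightarrow> real" where
  "qubo_objective Q c x =
     (\<Sum>i\<in>UNIV. \<Sum>j\<in>R Q i. Q $ i $ j * x $ i * x $ j) + (\<Sum>i\<in>UNIV. c $ i * x $ i)"

definition valid_qubo_formulation ::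
    "real^'n^'n \<Rightarrow> real^'n \<Rightarrow> ((real^'n) \<times> 'y \<Rightarrow> real) \<Rightarrow> ((real^'n) \<times> 'y) set \<Rightarrow> bool" where
  "valid_qubo_formulation Q c f S \<longleftrightarrow>
     (\<exists>v. is_optimal_value f S v \<and> is_optimal_value (qubo_objective Q c) binary_vectors v) \<and>
     (\<forall>x y. optimal_solution f S (x, y) \<longrightarrow>
        optimal_solution (qubo_objective Q c) binary_vectors x)"

definition milp_objective ::
    "real^'n^'n \<Rightarrow> real^'n \<Rightarrow> (real^'n) \<times> ('n \<times> 'n \<Rightarrow> real) \<Rightarrow> real" where
  "milp_objective Q c = (\<lambda>(x, y).
     (\<Sum>i\<in>UNIV. \<Sum>j\<in>R Q i. Q $ i $ j * y (i, j)) + (\<Sum>i\<in>UNIV. c $ i * x $ i))"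

text \<open>The variables \<open>y (i, j)\<close> exist only for \<open>j \<in> R Q i\<close>; the extensional function space fixes the
  value of \<open>y\<close> elsewhere. For symmetric \<open>Q\<close> the terms \<open>y (j, i)\<close> with \<open>j \<in> R Q i\<close> are among these
  variables.\<close>

definition GW_feasible ::
    "real^'n^'n \<Rightarrow> real^'n^'n \<Rightarrow> real^'n^'n \<Rightarrow> real^'n^'n \<Rightarrow> ((real^'n) \<times> ('n \<times> 'n \<Rightarrow> real)) set" where
  "GW_feasible Q \<alpha> \<gamma> \<delta> = {(x, y).
     (\<forall>i. (\<Sum>j\<in>R Q i. \<alpha> $ i $ j * (x $ j - y (i, j))) \<le> (\<Sum>j\<in>R Q i. \<alpha> $ i $ j) * (1 - x $ i)) \<and>
     (\<forall>i. (\<Sum>j\<in>R Q i. \<gamma> $ i $ j * y (i, j)) + (\<Sum>j\<in>R Q i. \<delta> $ i $ j * y (j, i))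
            \<le> ((\<Sum>j\<in>R Q i. \<gamma> $ i $ j) + (\<Sum>j\<in>R Q i. \<delta> $ i $ j)) * x $ i) \<and>
     x \<in> binary_vectors \<and>
     y \<in> (SIGMA i:UNIV. R Q i) \<rightarrow>\<^sub>E {0..1}}"

end

theory Submission
  imports Defs
begin

text \<open>In a feasible \<open>(x, y)\<close>, the second constraint at an index with \<open>x\<^sub>i = 0\<close> forces all
  \<open>y\<^sub>i\<^sub>j\<close> and \<open>y\<^sub>j\<^sub>i\<close> to vanish. The first constraint at an index with \<open>x\<^sub>i = 1\<close>
  then bounds a sum of nonnegative terms \<open>\<alpha>\<^sub>i\<^sub>j (x\<^sub>j - y\<^sub>i\<^sub>j)\<close> by zero. Hence
  \<open>y\<^sub>i\<^sub>j = x\<^sub>i x\<^sub>j\<close>, and as every binary \<open>x\<close> extends to a feasible point in this way,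
  both problems have the same values.\<close>

text \<open>A binary vector is the indicator of its support, so subsets of the index type enumerate
  all of them. Finiteness is what makes the QUBO maximum attained.\<close>

lemma finite_binary_vectors: "finite (binary_vectors :: (real^'n) set)"
proof (rule finite_surj)
  show "finite (UNIV :: 'n set set)"
    by simp
  show "binary_vectors \<subseteq> (\<lambda>A. \<chi> i. of_bool (i \<in> A)) ` (UNIV :: 'n set set)"
  proof
    fix x :: "real^'n" assume "x \<in> binary_vectors"
    then have "x = (\<chi> i. of_bool (i \<in> {i. x $ i = 1}))"
      by (auto simp: binary_vectors_def vec_eq_iff)
    then show "x \<in> range (\<lambda>A. \<chi> i. of_bool (i \<in> A))"
      by blast
  qed
qed

lemma ex_optimal_solution:
  assumes "finite S" "S \<noteq> {}"
  shows "\<exists>s. optimal_solution f S s"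
proof -
  obtain s where "s \<in> S" "f s = Max (f ` S)"
    using Max_in[of "f ` S"] assms by fastforce
  moreover from this have "f x \<le> f s" if "x \<in> S" for x
    using Max_ge[of "f ` S" "f x"] assms(1) that by simp
  ultimately show ?thesis
    by (auto simp: optimal_solution_def is_arg_max_def not_less)
qed

text \<open>The projection \<open>(x, y) \<mapsto> x\<close> maps \<open>S\<close> onto
  \<open>binary_vectors\<close> and preserves the objective. Strict improvements can therefore be
  projected by \<open>sound\<close> and lifted by \<open>complete\<close>, so optimality transfers
  both ways.\<close>

lemma valid_qubo_formulationI:
  assumes sound: "\<And>x y. (x, y) \<in> S \<Longrightarrow> x \<in> binary_vectors \<and> f (x, y) = qubo_objective Q c x"
    and complete: "\<And>x. x \<in> binary_vectors \<Longrightarrow> \<exists>y. (x, y) \<in> S"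
  shows "valid_qubo_formulation Q c f S"
proof -
  have optimal_iff: "optimal_solution f S (x, y) \<longleftrightarrow>
      (x, y) \<in> S \<and> optimal_solution (qubo_objective Q c) binary_vectors x" for x y
  proof -
    have "(\<exists>p\<in>S. f p > f (x, y)) \<longleftrightarrow> (\<exists>z\<in>binary_vectors. qubo_objective Q c z > qubo_objective Q c x)"
      if xy: "(x, y) \<in> S"
    proof
      assume "\<exists>p\<in>S. f p > f (x, y)"
      then obtain z w where "(z, w) \<in> S" "f (z, w) > f (x, y)"
        by auto
      then show "\<exists>z\<in>binary_vectors. qubo_objective Q c z > qubo_objective Q c x"
        using sound xy by metis
    next
      assume "\<exists>z\<in>binary_vectors. qubo_objective Q c z > qubo_objective Q c x"
      then show "\<exists>p\<in>S. f p > f (x, y)"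
        using sound xy complete by metis
    qed
    then show ?thesis
      using sound[of x y] by (auto simp: optimal_solution_def is_arg_max_def)
  qed
  \<comment> \<open>Attainment is obtained on the finite binary side and lifted to \<open>S\<close>,
    which may well be infinite.\<close>
  have "(0 :: real^'a) \<in> binary_vectors"
    by (simp add: binary_vectors_def)
  then obtain x where x: "optimal_solution (qubo_objective Q c) binary_vectors x"
    using ex_optimal_solution[OF finite_binary_vectors] by blast
  then obtain y where "(x, y) \<in> S"
    using complete by (auto simp: optimal_solution_def is_arg_max_def)
  then have "is_optimal_value f S (qubo_objective Q c x)"
    using x sound optimal_iff unfolding is_optimal_value_def by metis
  moreover have "is_optimal_value (qubo_objective Q c) binary_vectors (qubo_objective Q c x)"
    using x unfolding is_optimal_value_def by blast
  ultimately show ?thesis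
    using optimal_iff unfolding valid_qubo_formulation_def by blast
qed

text \<open>Applied with weights \<gamma> and \<delta> where \<open>x $ i = 0\<close>, and with
  weights \<alpha> where \<open>x $ i = 1\<close>.\<close>

lemma weighted_sum_nonpos_imp_zero:
  fixes w z :: "'a \<Rightarrow> real"
  assumes "finite A" "\<And>j. j \<in> A \<Longrightarrow> w j > 0" "\<And>j. j \<in> A \<Longrightarrow> z j \<ge> 0"
    and "(\<Sum>j\<in>A. w j * z j) \<le> 0" "j \<in> A"
  shows "z j = 0"
proof -
  have nonneg: "w i * z i \<ge> 0" if "i \<in> A" for i
    using assms(2,3)[OF that] by simp
  then have "(\<Sum>j\<in>A. w j * z j) = 0"
    using assms(4) by (meson antisym sum_nonneg)
  then have "w j * z j = 0"
    using nonneg assms(1,5) by (simp add: sum_nonneg_eq_0_iff)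
  then show ?thesis
    using assms(2)[OF assms(5)] by simp
qed

text \<open>Symmetry makes \<open>y (j, i)\<close> a genuine variable whenever
  \<open>y (i, j)\<close> is one, so its bounds are available too.\<close>

lemma R_sym:
  assumes "transpose Q = Q" "j \<in> R Q i"
  shows "i \<in> R Q j"
proof -
  have "Q $ j $ i = transpose Q $ i $ j"
    by (simp add: transpose_def)
  then show ?thesis
    using assms by (simp add: R_def)
qed

lemma binary_vectors_cases:
  assumes "x \<in> binary_vectors"
  obtains "x $ i = 0" | "x $ i = 1"
  using assms by (auto simp: binary_vectors_def)

lemma GW_feasible_imp_product:
  assumes sym: "transpose Q = Q"
    and \<alpha>: "\<And>i j. j \<in> R Q i \<Longrightarrow> \<alpha> $ i $ j > 0"
    and \<gamma>: "\<And>i j. j \<in> R Q i \<Longrightarrow> \<gamma> $ i $ j > 0"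
    and \<delta>: "\<And>i j. j \<in> R Q i \<Longrightarrow> \<delta> $ i $ j > 0"
    and feasible: "(x, y) \<in> GW_feasible Q \<alpha> \<gamma> \<delta>"
    and j: "j \<in> R Q i"
  shows "y (i, j) = x $ i * x $ j"
proof -
  have first: "(\<Sum>j\<in>R Q i. \<alpha> $ i $ j * (x $ j - y (i, j))) \<le> (\<Sum>j\<in>R Q i. \<alpha> $ i $ j) * (1 - x $ i)"
    and second: "(\<Sum>j\<in>R Q i. \<gamma> $ i $ j * y (i, j)) + (\<Sum>j\<in>R Q i. \<delta> $ i $ j * y (j, i))
        \<le> ((\<Sum>j\<in>R Q i. \<gamma> $ i $ j) + (\<Sum>j\<in>R Q i. \<delta> $ i $ j)) * x $ i" for i
    using feasible by (auto simp: GW_feasible_def)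
  have x: "x \<in> binary_vectors"
    using feasible by (simp add: GW_feasible_def)
  have y: "0 \<le> y (i, j)" "y (i, j) \<le> 1" if "j \<in> R Q i" for i j
    using feasible that by (auto simp: GW_feasible_def PiE_iff)
  have zero: "y (i, j) = 0 \<and> y (j, i) = 0" if "x $ i = 0" "j \<in> R Q i" for i j
  proof -
    have y': "0 \<le> y (k, i)" if "k \<in> R Q i" for k
      using y R_sym[OF sym that] by blast
    \<comment> \<open>The constraint bounds only the total of the two sums; nonnegativity of each
      lets the bound 0 pass to both.\<close>
    have "0 \<le> (\<Sum>j\<in>R Q i. \<gamma> $ i $ j * y (i, j))" "0 \<le> (\<Sum>j\<in>R Q i. \<delta> $ i $ j * y (j, i))"
      by (intro sum_nonneg mult_nonneg_nonneg less_imp_le[OF \<gamma>] less_imp_le[OF \<delta>] y y'; assumption)+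
    then have "(\<Sum>j\<in>R Q i. \<gamma> $ i $ j * y (i, j)) \<le> 0" "(\<Sum>j\<in>R Q i. \<delta> $ i $ j * y (j, i)) \<le> 0"
      using second[of i] \<open>x $ i = 0\<close> by auto
    then show ?thesis
      using weighted_sum_nonpos_imp_zero[of "R Q i" "\<lambda>j. \<gamma> $ i $ j" "\<lambda>j. y (i, j)" j]
        weighted_sum_nonpos_imp_zero[of "R Q i" "\<lambda>j. \<delta> $ i $ j" "\<lambda>j. y (j, i)" j]
        \<gamma> \<delta> y y' \<open>j \<in> R Q i\<close> by auto
  qed
  show ?thesis
  proof (cases rule: binary_vectors_cases[OF x, of i])
    case 1
    then show ?thesis
      using zero j by simp
  next
    case 2
    \<comment> \<open>If \<open>x $ k = 0\<close>, the second constraint is used at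
      \<open>k\<close>, not at \<open>i\<close>: its \<delta>-terms contain \<open>y (i, k)\<close>.
      If \<open>x $ k = 1\<close>, the upper bound on \<open>y (i, k)\<close> suffices.\<close>
    have "x $ k - y (i, k) \<ge> 0" if "k \<in> R Q i" for k
    proof (cases rule: binary_vectors_cases[OF x, of k])
      case 1
      then show ?thesis
        using zero[OF 1 R_sym[OF sym that]] by simp
    next
      case 2
      then show ?thesis
        using y[OF that] by simp
    qed
    then have "x $ j - y (i, j) = 0"
      using weighted_sum_nonpos_imp_zero[of "R Q i" "\<lambda>j. \<alpha> $ i $ j" "\<lambda>j. x $ j - y (i, j)" j]
        \<alpha> j first[of i] 2 by simp
    then show ?thesis
      using 2 by simp
  qed
qed

text \<open>Both constraints hold term by term, from
  \<open>x $ j * (1 - x $ i) \<le> 1 - x $ i\<close> and \<open>x $ i * x $ j \<le> x $ i\<close>,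
  so nonnegative weights suffice.\<close>

lemma product_GW_feasible:
  assumes sym: "transpose Q = Q"
    and \<alpha>: "\<And>i j. j \<in> R Q i \<Longrightarrow> \<alpha> $ i $ j \<ge> 0"
    and \<gamma>: "\<And>i j. j \<in> R Q i \<Longrightarrow> \<gamma> $ i $ j \<ge> 0"
    and \<delta>: "\<And>i j. j \<in> R Q i \<Longrightarrow> \<delta> $ i $ j \<ge> 0"
    and x: "x \<in> binary_vectors"
  shows "(x, restrict (\<lambda>(i, j). x $ i * x $ j) (SIGMA i:UNIV. R Q i)) \<in> GW_feasible Q \<alpha> \<gamma> \<delta>"
    (is "(x, ?y) \<in> _")
proof -
  have bounds: "0 \<le> x $ i" "x $ i \<le> 1" for i
    by (cases rule: binary_vectors_cases[OF x, of i]; simp)+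
  \<comment> \<open>The second equation needs \<open>R_sym\<close>: outside the index set
    \<open>restrict\<close> returns \<open>undefined\<close>.\<close>
  have y: "?y (i, j) = x $ i * x $ j" "?y (j, i) = x $ i * x $ j" if "j \<in> R Q i" for i j
    using that R_sym[OF sym that] by auto
  have "(\<Sum>j\<in>R Q i. \<alpha> $ i $ j * (x $ j - ?y (i, j))) \<le> (\<Sum>j\<in>R Q i. \<alpha> $ i $ j) * (1 - x $ i)" for i
    unfolding sum_distrib_right
  proof (rule sum_mono)
    fix j assume j: "j \<in> R Q i"
    have "x $ j - ?y (i, j) = x $ j * (1 - x $ i)"
      unfolding y(1)[OF j] by (simp add: algebra_simps)
    also have "\<dots> \<le> 1 - x $ i"
      using bounds by (simp add: mult_left_le_one_le)
    finally show "\<alpha> $ i $ j * (x $ j - ?y (i, j)) \<le> \<alpha> $ i $ j * (1 - x $ i)"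
      using \<alpha>[OF j] by (rule mult_left_mono)
  qed
  moreover have "(\<Sum>j\<in>R Q i. \<gamma> $ i $ j * ?y (i, j)) + (\<Sum>j\<in>R Q i. \<delta> $ i $ j * ?y (j, i))
      \<le> ((\<Sum>j\<in>R Q i. \<gamma> $ i $ j) + (\<Sum>j\<in>R Q i. \<delta> $ i $ j)) * x $ i" for i
    unfolding distrib_right sum_distrib_right
  proof (intro add_mono sum_mono)
    fix j assume j: "j \<in> R Q i"
    have "x $ i * x $ j \<le> x $ i"
      using bounds by (simp add: mult_left_le)
    then show "\<gamma> $ i $ j * ?y (i, j) \<le> \<gamma> $ i $ j * x $ i" "\<delta> $ i $ j * ?y (j, i) \<le> \<delta> $ i $ j * x $ i"
      unfolding y[OF j] using \<gamma>[OF j] \<delta>[OF j] by (auto intro: mult_left_mono)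
  qed
  moreover have "?y \<in> (SIGMA i:UNIV. R Q i) \<rightarrow>\<^sub>E {0..1}"
    using bounds by (auto simp: PiE_iff mult_le_one)
  ultimately show ?thesis
    unfolding GW_feasible_def using x by blast
qed

theorem theorem11:
  fixes Q \<alpha> \<gamma> \<delta> :: "real^'n^'n" and c :: "real^'n"
  assumes "transpose Q = Q"
    and "\<And>i. Q $ i $ i = 0"
    and "\<And>i j. j \<in> R Q i \<Longrightarrow> \<alpha> $ i $ j > 0"
    and "\<And>i j. j \<in> R Q i \<Longrightarrow> \<gamma> $ i $ j > 0"
    and "\<And>i j. j \<in> R Q i \<Longrightarrow> \<delta> $ i $ j > 0"
  shows "valid_qubo_formulation Q c (milp_objective Q c) (GW_feasible Q \<alpha> \<gamma> \<delta>)"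
proof (rule valid_qubo_formulationI)
  fix x y assume feasible: "(x, y) \<in> GW_feasible Q \<alpha> \<gamma> \<delta>"
  then have "y (i, j) = x $ i * x $ j" if "j \<in> R Q i" for i j
    using GW_feasible_imp_product assms(1,3,4,5) that by blast
  \<comment> \<open>The objective reads \<open>y\<close> only at pairs with
    \<open>j \<in> R Q i\<close>, where it is the product.\<close>
  then have "milp_objective Q c (x, y) = qubo_objective Q c x"
    by (simp add: milp_objective_def qubo_objective_def mult.assoc)
  then show "x \<in> binary_vectors \<and> milp_objective Q c (x, y) = qubo_objective Q c x"
    using feasible by (simp add: GW_feasible_def)
next
  fix x :: "real^'n" assume "x \<in> binary_vectors"
  then show "\<exists>y. (x, y) \<in> GW_feasible Q \<alpha> \<gamma> \<delta>"
    using product_GW_feasible[of Q \<alpha> \<gamma> \<delta> x] assms(1,3,4,5) less_imp_le by blast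
qed

end
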